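(* Let $\lambda=(1^{a_1},2^{a_2},\ldots,n^{a_n})\vdash n$. Then \begin{enumerate} \item $\mathbb{E}_{\lambda}[\operatorname{cda}]=\frac{n-a_1-2a_2}{6}=\mathbb{E}_{\lambda}[\operatorname{cdd}]$, and \item $\mathbb{E}_{\lambda}[\operatorname{cv}]=\frac{n-a_1+a_2}{3}=\mathbb{E}_{\lambda}[\operatorname{cpk}]$. \end{enumerate}
   Context: For $\omega\in S_n$, an element $i\in[n]$ is a cyclic valley if $\omega^{-1}(i)>i<\omega(i)$, a cyclic peak if $\omega^{-1}(i)<i>\omega(i)$, a cyclic double ascent if $\omega^{-1}(i)<i<\omega(i)$, and a cyclic double descent if $\omega^{-1}(i)>i>\omega(i)$. $\operatorname{cv}(\omega)$, $\operatorname{cpk}(\omega)$, $\operatorname{cda}(\omega)$, $\operatorname{cdd}(\omega)$ denote the numbers of cyclic valleys, cyclic peaks, cyclic double ascents and cyclic double descents of $\omega$, respectively. The partition $\lambda$ has $a_i$ parts equal to $i$; $\mathbb{E}_\lambda$ denotes expectation under the uniform measure on the conjugacy class $C_\lambda$ of $S_n$ of cycle type $\lambda$. *)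

theory Defs
  imports "HOL-Probability.Probability" "HOL-Combinatorics.Orbits"
begin

text \<open>
  Elements of \<open>S\<^sub>n\<close> are the functions \<open>w\<close> with \<open>w permutes {1..n}\<close>.
  A partition is the multiset of its parts; the number
  \<open>a\<^sub>i\<close> of parts equal to \<open>i\<close> is \<open>count mu i\<close>.
\<close>

definition partition_of :: "nat multiset \<Rightarrow> nat \<Rightarrow> bool"  (infix \<open>\<turnstile>\<^sub>p\<close> 50) where
  "mu \<turnstile>\<^sub>p n \<longleftrightarrow> 0 \<notin># mu \<and> sum_mset mu = n"

text \<open>
  The orbits are collected into a set before their sizes are taken, so every cycle is
  counted once, and fixed points contribute parts equal to 1.
\<close>

definition cycle_type :: "nat \<Rightarrow> (nat \<Rightarrow> nat) \<Rightarrow> nat multiset" where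
  "cycle_type n w = image_mset card (mset_set (orbit w ` {1..n}))"

definition conj_class :: "nat \<Rightarrow> nat multiset \<Rightarrow> (nat \<Rightarrow> nat) set" where
  "conj_class n mu = {w. w permutes {1..n} \<and> cycle_type n w = mu}"

definition cyclic_valley :: "(nat \<Rightarrow> nat) \<Rightarrow> nat \<Rightarrow> bool" where
  "cyclic_valley w i \<longleftrightarrow> inv w i > i \<and> i < w i"

definition cyclic_peak :: "(nat \<Rightarrow> nat) \<Rightarrow> nat \<Rightarrow> bool" where
  "cyclic_peak w i \<longleftrightarrow> inv w i < i \<and> i > w i"

definition cyclic_double_ascent :: "(nat \<Rightarrow> nat) \<Rightarrow> nat \<Rightarrow> bool" where
  "cyclic_double_ascent w i \<longleftrightarrow> inv w i < i \<and> i < w i"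

definition cyclic_double_descent :: "(nat \<Rightarrow> nat) \<Rightarrow> nat \<Rightarrow> bool" where
  "cyclic_double_descent w i \<longleftrightarrow> inv w i > i \<and> i > w i"

definition cv :: "nat \<Rightarrow> (nat \<Rightarrow> nat) \<Rightarrow> nat" where
  "cv n w = card {i \<in> {1..n}. cyclic_valley w i}"

definition cpk :: "nat \<Rightarrow> (nat \<Rightarrow> nat) \<Rightarrow> nat" where
  "cpk n w = card {i \<in> {1..n}. cyclic_peak w i}"

definition cda :: "nat \<Rightarrow> (nat \<Rightarrow> nat) \<Rightarrow> nat" where
  "cda n w = card {i \<in> {1..n}. cyclic_double_ascent w i}"

definition cdd :: "nat \<Rightarrow> (nat \<Rightarrow> nat) \<Rightarrow> nat" where
  "cdd n w = card {i \<in> {1..n}. cyclic_double_descent w i}"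

text \<open>
  \<open>pmf_of_set\<close> is the uniform distribution only on finite nonempty sets; \<open>conj_class n mu\<close> is
  finite, and it is nonempty whenever \<open>mu \<turnstile>\<^sub>p n\<close>.
\<close>

definition class_expectation ::
    "nat \<Rightarrow> nat multiset \<Rightarrow> (nat \<Rightarrow> (nat \<Rightarrow> nat) \<Rightarrow> nat) \<Rightarrow> real" where
  "class_expectation n mu X =
     measure_pmf.expectation (pmf_of_set (conj_class n mu)) (\<lambda>w. real (X n w))"

end

theory Submission
  imports Defs
begin

text \<open>
  Conjugation by \<open>\<sigma>\<close> permutes a conjugacy class, so the class average of a statistic can be computed
  by first averaging over all conjugates \<open>\<sigma> w \<sigma>\<^sup>-\<^sup>1\<close> of a fixed \<open>w\<close>.  Writing \<open>i = \<sigma> j\<close>, this amounts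
  to counting the \<open>\<sigma>\<close> that put the values at \<open>w\<^sup>-\<^sup>1 j\<close>, \<open>j\<close>, \<open>w j\<close> in a prescribed relative order.
  If \<open>j\<close> lies on a cycle of length at least 3, these points are distinct and all six orders are equally
  likely; on a 2-cycle the outer points coincide and there are two equally likely orders.
\<close>

subsection \<open>Relative orders of the values of a random permutation\<close>

text \<open>Precomposing with the transposition of \<open>a\<close> and \<open>b\<close> exchanges
  the two possible orders. Since \<open>p\<close> is injective, exactly one of them occurs for each
  \<open>p\<close>, so each takes half of all permutations.\<close>

lemma sum_of_bool_permutes_less:
  fixes S :: "'a::linorder set"
  assumes "finite S" "a \<in> S" "b \<in> S" "a \<noteq> b"
  shows "(\<Sum>p | p permutes S. of_bool (p a < p b)) = (fact (card S) / 2 :: real)"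
proof -
  let ?P = "\<lambda>a b. \<Sum>p | p permutes S. of_bool (p a < p b) :: real"
  have "?P a b = ?P b a"
    by (rule trans[OF sum_permutations_compose_right[OF permutes_swap_id[OF assms(2,3)]]]) simp
  moreover have "?P a b + ?P b a = (\<Sum>p | p permutes S. 1)"
    unfolding sum.distrib[symmetric]
  proof (rule sum.cong)
    fix p assume "p \<in> {p. p permutes S}"
    then have "p a \<noteq> p b"
      using assms(4) by (auto dest: permutes_inj injD)
    then show "of_bool (p a < p b) + of_bool (p b < p a) = (1::real)"
      by auto
  qed simp
  moreover have "(\<Sum>p | p permutes S. 1) = (fact (card S) :: real)"
    using card_permutations[OF refl assms(1)] by simp
  ultimately show ?thesis by linarith
qed

lemma sum_of_bool_permutes_less_less:
  fixes S :: "'a::linorder set"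
  assumes "finite S" "a \<in> S" "b \<in> S" "c \<in> S" "a \<noteq> b" "b \<noteq> c" "a \<noteq> c"
  shows "(\<Sum>p | p permutes S. of_bool (p a < p b \<and> p b < p c)) = (fact (card S) / 6 :: real)"
proof -
  define P where "P a b c = (\<Sum>p | p permutes S. of_bool (p a < p b \<and> p b < p c) :: real)" for a b c
  \<comment> \<open>Reindexing the sum by \<open>p\<close> to \<open>p \<circ> q\<close> moves the
    three points by \<open>q\<close>. Taking for \<open>q\<close> a transposition that fixes the
    third point swaps two neighbouring arguments, and such swaps reach all six arrangements.\<close>
  have P: "P x y z = P (q x) (q y) (q z)" if "q permutes S" for q x y z
    unfolding P_def by (rule trans[OF sum_permutations_compose_right[OF that]]) simp
  have swap12: "P x y z = P y x z" if "x \<in> S" "y \<in> S" "z \<noteq> x" "z \<noteq> y" for x y z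
    by (rule trans[OF P[OF permutes_swap_id[OF that(1,2)]]]) (use that in simp)
  have swap23: "P x y z = P x z y" if "y \<in> S" "z \<in> S" "x \<noteq> y" "x \<noteq> z" for x y z
    by (rule trans[OF P[OF permutes_swap_id[OF that(1,2)]]]) (use that in simp)
  have eqs: "P a c b = P a b c" "P b a c = P a b c" "P b c a = P a b c"
    "P c a b = P a b c" "P c b a = P a b c"
    by (metis swap12 swap23 assms(2-7))+
  \<comment> \<open>The six orders are exclusive and exhaustive for an injective \<open>p\<close>,
    so their indicators add up to 1.\<close>
  have "P a b c + P a c b + P b a c + P b c a + P c a b + P c b a = (\<Sum>p | p permutes S. 1)"
    unfolding P_def sum.distrib[symmetric]
  proof (rule sum.cong)
    fix p assume "p \<in> {p. p permutes S}"
    then have "inj p" using permutes_inj by auto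
    then have "p a \<noteq> p b" "p b \<noteq> p c" "p a \<noteq> p c"
      using assms(5-7) by (auto dest: injD)
    then show "of_bool (p a < p b \<and> p b < p c) + of_bool (p a < p c \<and> p c < p b) +
        of_bool (p b < p a \<and> p a < p c) + of_bool (p b < p c \<and> p c < p a) +
        of_bool (p c < p a \<and> p a < p b) + of_bool (p c < p b \<and> p b < p a) = (1::real)"
      by (cases "p a" "p b" rule: linorder_cases; cases "p b" "p c" rule: linorder_cases;
          cases "p a" "p c" rule: linorder_cases) (auto dest: less_trans less_asym)
  qed simp
  also have "\<dots> = (fact (card S) :: real)"
    using card_permutations[OF refl assms(1)] by simp
  finally show ?thesis
    unfolding eqs by (simp add: P_def)
qed

text \<open>The order of the two outer values is left free, so the event is the disjoint union of
  two of the six orders, and 2/6 = 1/3.\<close>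

lemma sum_of_bool_permutes_middle_least:
  fixes S :: "'a::linorder set"
  assumes "finite S" "a \<in> S" "b \<in> S" "c \<in> S" "a \<noteq> b" "b \<noteq> c" "a \<noteq> c"
  shows "(\<Sum>p | p permutes S. of_bool (p b < p a \<and> p b < p c)) = (fact (card S) / 3 :: real)"
proof -
  have "(\<Sum>p | p permutes S. of_bool (p b < p a \<and> p b < p c)) =
      (\<Sum>p | p permutes S. of_bool (p b < p a \<and> p a < p c) + of_bool (p b < p c \<and> p c < p a) :: real)"
  proof (rule sum.cong)
    fix p assume "p \<in> {p. p permutes S}"
    then have "p a \<noteq> p c" using assms(7) by (auto dest: permutes_inj injD)
    then show "of_bool (p b < p a \<and> p b < p c) =
        (of_bool (p b < p a \<and> p a < p c) + of_bool (p b < p c \<and> p c < p a) :: real)"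
      by (cases "p a" "p c" rule: linorder_cases) (auto dest: less_trans less_asym)
  qed simp
  then show ?thesis
    using sum_of_bool_permutes_less_less[of S b a c] sum_of_bool_permutes_less_less[of S b c a] assms
    by (simp add: sum.distrib)
qed

lemma sum_of_bool_permutes_middle_greatest:
  fixes S :: "'a::linorder set"
  assumes "finite S" "a \<in> S" "b \<in> S" "c \<in> S" "a \<noteq> b" "b \<noteq> c" "a \<noteq> c"
  shows "(\<Sum>p | p permutes S. of_bool (p a < p b \<and> p c < p b)) = (fact (card S) / 3 :: real)"
proof -
  have "(\<Sum>p | p permutes S. of_bool (p a < p b \<and> p c < p b)) =
      (\<Sum>p | p permutes S. of_bool (p a < p c \<and> p c < p b) + of_bool (p c < p a \<and> p a < p b) :: real)"
  proof (rule sum.cong)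
    fix p assume "p \<in> {p. p permutes S}"
    then have "p a \<noteq> p c" using assms(7) by (auto dest: permutes_inj injD)
    then show "of_bool (p a < p b \<and> p c < p b) =
        (of_bool (p a < p c \<and> p c < p b) + of_bool (p c < p a \<and> p a < p b) :: real)"
      by (cases "p a" "p c" rule: linorder_cases) (auto dest: less_trans less_asym)
  qed simp
  then show ?thesis
    using sum_of_bool_permutes_less_less[of S a c b] sum_of_bool_permutes_less_less[of S c a b] assms
    by (simp add: sum.distrib)
qed

subsection \<open>Cycle types\<close>

lemma card_orbit_eq_1_iff:
  assumes "permutation w"
  shows "card (orbit w j) = 1 \<longleftrightarrow> w j = j"
  using eq_on_cyclic_on_iff1[OF cyclic_on_orbit'[OF assms, of j] permutation_self_in_orbit[OF assms]]
  by blast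

lemma card_orbit_eq_2_iff:
  assumes "permutation w"
  shows "card (orbit w j) = 2 \<longleftrightarrow> w j \<noteq> j \<and> w (w j) = j"
proof
  assume 2: "card (orbit w j) = 2"
  have ne: "w j \<noteq> j"
    using card_orbit_eq_1_iff[OF assms, of j] 2 by simp
  have mem: "j \<in> orbit w j" "w j \<in> orbit w j" "w (w j) \<in> orbit w j"
    using permutation_self_in_orbit[OF assms] by (auto intro: orbit.intros)
  \<comment> \<open>Two distinct points already exhaust an orbit of size 2, so
    \<open>w (w j)\<close> must be one of them; injectivity of \<open>w\<close> then excludes
    \<open>w j\<close>.\<close>
  then have "{j, w j} = orbit w j"
    using 2 ne by (intro card_subset_eq) (auto intro: card_ge_0_finite)
  then have "w (w j) = j \<or> w (w j) = w j" using mem by blast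
  then show "w j \<noteq> j \<and> w (w j) = j"
    using ne permutation_bijective[OF assms] by (metis bij_pointE)
next
  assume w: "w j \<noteq> j \<and> w (w j) = j"
  have "orbit w j = {(w ^^ m) j | m. m < 2}"
    using w by (intro orbit_altdef_bounded) (auto simp: numeral_2_eq_2)
  also have "\<dots> = {j, w j}"
    by (auto simp: numeral_2_eq_2 less_Suc_eq intro: exI[of _ 0] exI[of _ "Suc 0"])
  finally show "card (orbit w j) = 2" using w by auto
qed

text \<open>The points on cycles of length \<open>k\<close> form the disjoint union of the orbits of
  size \<open>k\<close>. With \<open>k\<close> equal to 1 and 2 this turns the multiplicities in the
  partition into numbers of fixed points and of points on 2-cycles.\<close>

lemma card_orbit_size:
  assumes "w permutes {1..n}"
  shows "card {j \<in> {1..n}. card (orbit w j) = k} = k * count (cycle_type n w) k"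
proof -
  let ?O = "{A \<in> orbit w ` {1..n}. card A = k}"
  have perm: "permutation w" using assms permutation_permutes by blast
  have eq: "orbit w i = orbit w j" if "x \<in> orbit w i" "x \<in> orbit w j" for x i j
    using orbit_cyclic_eq3[OF cyclic_on_orbit'[OF perm]] that by metis
  have "{j \<in> {1..n}. card (orbit w j) = k} = \<Union>?O"
  proof (intro equalityI subsetI)
    fix j assume "j \<in> {j \<in> {1..n}. card (orbit w j) = k}"
    then show "j \<in> \<Union>?O" using permutation_self_in_orbit[OF perm, of j] by blast
  next
    fix j assume "j \<in> \<Union>?O"
    then obtain i where i: "i \<in> {1..n}" "card (orbit w i) = k" "j \<in> orbit w i" by auto
    have "orbit w j = orbit w i"
      using eq[OF permutation_self_in_orbit[OF perm, of j] i(3)] .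
    moreover have "j \<in> {1..n}"
      using permutes_orbit_subset[OF assms i(1)] i(3) by (rule subsetD)
    ultimately show "j \<in> {j \<in> {1..n}. card (orbit w j) = k}"
      using i(2) by simp
  qed
  also have "card (\<Union>?O) = k * card ?O"
    using eq by (subst card_partition[symmetric])
      (auto simp: finite_orbit[OF permutation_self_in_orbit[OF perm]])
  also have "card ?O = count (cycle_type n w) k"
    unfolding cycle_type_def count_image_mset' by (auto intro: arg_cong[of _ _ card])
  finally show ?thesis .
qed

text \<open>The orbits of the conjugate are the images under \<open>p\<close> of the orbits of
  \<open>w\<close>. Injectivity of \<open>p\<close> keeps distinct orbits distinct and preserves
  their sizes, so the multisets of sizes agree.\<close>

lemma cycle_type_conj:
  assumes w: "w permutes {1..n}" and p: "p permutes {1..n}"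
  shows "cycle_type n (p \<circ> w \<circ> inv p) = cycle_type n w"
proof -
  have perm: "permutation w" using w permutation_permutes by blast
  have inj: "inj p" using p permutes_inj by blast
  have orb: "orbit (p \<circ> w \<circ> inv p) (p j) = p ` orbit w j" for j
    by (rule orbit_inverse[symmetric, OF permutation_self_in_orbit[OF perm]])
      (simp add: inv_f_f[OF inj])
  have "orbit (p \<circ> w \<circ> inv p) ` {1..n} = orbit (p \<circ> w \<circ> inv p) ` p ` {1..n}"
    using permutes_image[OF p] by simp
  also have "\<dots> = image p ` orbit w ` {1..n}"
    by (simp add: image_image orb)
  finally have "mset_set (orbit (p \<circ> w \<circ> inv p) ` {1..n}) =
      image_mset (image p) (mset_set (orbit w ` {1..n}))"
    using inj by (simp add: image_mset_mset_set inj_on_def inj_image_eq_iff)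
  then show ?thesis
    unfolding cycle_type_def
    by (simp add: multiset.map_comp o_def card_image inj_on_subset[OF inj])
qed

section \<open>Constructing a permutation of prescribed cycle type\<close>

lemma ex_cyclic_permutes_interval:
  fixes m k :: nat
  assumes "0 < k"
  obtains c where "c permutes {m+1..m+k}" "cyclic_on c {m+1..m+k}"
proof
  \<comment> \<open>On the block this is the successor map with \<open>m+k\<close> sent back to
    \<open>m+1\<close>: the residue of \<open>i - m\<close> is zero exactly at the last
    point.\<close>
  define c where "c i = (if i \<in> {m+1..m+k} then m + 1 + (i - m) mod k else i)" for i
  have iter: "(c ^^ t) (m+1) = m + 1 + t mod k" for t
  proof (induction t)
    case (Suc t)
    have "t mod k < k" using assms by simp
    then have "c (m + 1 + t mod k) = m + 1 + Suc t mod k" by (simp add: c_def mod_Suc_eq)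
    then show ?case using Suc by simp
  qed simp
  have orb: "{m+1..m+k} = orbit c (m+1)"
  proof (intro equalityI subsetI)
    fix x assume "x \<in> {m+1..m+k}"
    then obtain d where "x = m + 1 + d" "d < k"
      using that[of "x - m - 1"] by auto
    \<comment> \<open>The extra full turn of \<open>k\<close> steps makes the exponent positive even
      for \<open>d = 0\<close>, as an orbit consists of positive iterates.\<close>
    then have "x = (c ^^ (k + d)) (m+1)"
      unfolding iter by simp
    then show "x \<in> orbit c (m+1)" using assms by (auto simp: orbit_altdef)
  next
    fix x assume "x \<in> orbit c (m+1)"
    then obtain t where "x = m + 1 + t mod k"
      unfolding orbit_altdef iter by blast
    then show "x \<in> {m+1..m+k}"
      using assms by (simp add: Suc_le_eq)
  qed
  show cyc: "cyclic_on c {m+1..m+k}"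
    by (rule cyclic_on_singleI[OF _ orb]) (use assms in simp)
  have "c ` {m+1..m+k} = {m+1..m+k}"
  proof (rule equalityI)
    show "c ` {m+1..m+k} \<subseteq> {m+1..m+k}"
      by (rule image_subsetI) (rule cyclic_on_inI[OF cyc])
  next
    show "{m+1..m+k} \<subseteq> c ` {m+1..m+k}"
    proof
      fix x assume "x \<in> {m+1..m+k}"
      then have "x \<in> orbit c (m+1)" unfolding orb .
      then show "x \<in> c ` {m+1..m+k}"
      proof cases
        case base
        then show ?thesis using assms by auto
      next
        case (step y)
        then show ?thesis unfolding orb[symmetric] by (rule image_eqI)
      qed
    qed
  qed
  \<comment> \<open>A surjection of a finite set onto itself is injective.\<close>
  then have "bij_betw c {m+1..m+k} {m+1..m+k}"
    by (simp add: bij_betw_def eq_card_imp_inj_on)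
  then show "c permutes {m+1..m+k}"
    by (rule bij_imp_permutes) (auto simp: c_def)
qed

text \<open>This makes the conjugacy class nonempty, so that the uniform distribution on it makes
  sense. By induction on the parts, a new part \<open>k\<close> is realised by a
  \<open>k\<close>-cycle on a fresh block above the points already used.\<close>

lemma ex_cycle_type:
  assumes "mu \<turnstile>\<^sub>p n"
  shows "\<exists>w. w permutes {1..n} \<and> cycle_type n w = mu"
  using assms
proof (induction mu arbitrary: n)
  case empty
  then show ?case
    by (auto simp: partition_of_def cycle_type_def)
next
  case (add k mu)
  define m where "m = sum_mset mu"
  have k: "0 < k" and n: "n = m + k" and mu: "mu \<turnstile>\<^sub>p m"
    using add.prems by (auto simp: partition_of_def m_def)
  obtain w where w: "w permutes {1..m}" "cycle_type m w = mu"
    using add.IH[OF mu] by blast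
  let ?T = "{m+1..m+k}"
  obtain c where c: "c permutes ?T" "cyclic_on c ?T"
    using ex_cyclic_permutes_interval[OF k] by blast
  have perm: "permutation w" using w(1) permutation_permutes by blast
  have split: "{1..n} = {1..m} \<union> ?T" using n by auto
  have wc: "w \<circ> c permutes {1..n}"
    unfolding split
    by (intro permutes_compose permutes_subset[OF c(1)] permutes_subset[OF w(1)]) auto
  have orbw: "orbit w x \<subseteq> {1..m}" if "x \<in> {1..m}" for x
    using permutes_orbit_subset[OF w(1) that] .
  have orb1: "orbit (w \<circ> c) x = orbit w x" if "x \<in> {1..m}" for x
  proof (rule orbit_cong[OF permutation_self_in_orbit[OF perm]])
    fix s assume "s \<in> orbit w x"
    then have "c s = s" using orbw[OF that] by (intro permutes_not_in[OF c(1)]) auto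
    then show "(w \<circ> c) s = w s" by simp
  qed
  have "cyclic_on (w \<circ> c) ?T"
    by (rule permutes_comp_preserves_cyclic2[OF w(1) c(2), where B = ?T]) auto
  then have orb2: "orbit (w \<circ> c) x = ?T" if "x \<in> ?T" for x
    using that by (rule orbit_cyclic_eq3)
  have "orbit (w \<circ> c) ` ?T = {?T}" using orb2 k by force
  then have "orbit (w \<circ> c) ` {1..n} = insert ?T (orbit w ` {1..m})"
    unfolding split image_Un using orb1 by simp
  \<comment> \<open>The orbits are collected in a set, so the new block adds a part only if it is
    not already among them.\<close>
  moreover have "?T \<notin> orbit w ` {1..m}"
  proof
    assume "?T \<in> orbit w ` {1..m}"
    then have "?T \<subseteq> {1..m}" using orbw by (metis imageE)
    then show False using k by auto
  qed
  ultimately have "cycle_type n (w \<circ> c) = add_mset k (cycle_type m w)"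
    by (simp add: cycle_type_def)
  then show ?case using wc w(2) by auto
qed

subsection \<open>Averaging over a conjugacy class\<close>

lemma finite_conj_class: "finite (conj_class n mu)"
  by (rule finite_subset[OF _ finite_permutations[of "{1..n}"]]) (auto simp: conj_class_def)

lemma conj_mem_conj_class:
  assumes "p permutes {1..n}" "w \<in> conj_class n mu"
  shows "p \<circ> w \<circ> inv p \<in> conj_class n mu"
proof -
  have w: "w permutes {1..n}" "cycle_type n w = mu"
    using assms(2) by (simp_all add: conj_class_def)
  have "p \<circ> w \<circ> inv p permutes {1..n}"
    by (intro permutes_compose permutes_inv assms(1) w(1))
  then show ?thesis
    using cycle_type_conj[OF w(1) assms(1)] w(2) by (simp only: conj_class_def mem_Collect_eq)
qed

lemma bij_betw_conj_class:
  assumes p: "p permutes {1..n}"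
  shows "bij_betw (\<lambda>w. p \<circ> w \<circ> inv p) (conj_class n mu) (conj_class n mu)"
proof (rule bij_betwI[where g = "\<lambda>w. inv p \<circ> w \<circ> p"])
  show "(\<lambda>w. p \<circ> w \<circ> inv p) \<in> conj_class n mu \<rightarrow> conj_class n mu"
    using conj_mem_conj_class[OF p] by (rule funcsetI)
  show "(\<lambda>w. inv p \<circ> w \<circ> p) \<in> conj_class n mu \<rightarrow> conj_class n mu"
    using conj_mem_conj_class[OF permutes_inv[OF p]] unfolding permutes_inv_inv[OF p]
    by (rule funcsetI)
  show "inv p \<circ> (p \<circ> w \<circ> inv p) \<circ> p = w" "p \<circ> (inv p \<circ> w \<circ> p) \<circ> inv p = w" for w
    by (simp_all add: fun_eq_iff permutes_inverses[OF p])
qed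

text \<open>Double counting over pairs of a conjugating \<open>p\<close> and a class member
  \<open>w\<close>: for fixed \<open>p\<close> the inner sum is the class total, as conjugation
  permutes the class; for fixed \<open>w\<close> it is \<open>fact n * K\<close>. Comparing the two
  gives the mean.\<close>

lemma class_expectation_eqI:
  assumes mu: "mu \<turnstile>\<^sub>p n"
    and avg: "\<And>w. w \<in> conj_class n mu \<Longrightarrow>
      (\<Sum>p | p permutes {1..n}. real (X n (p \<circ> w \<circ> inv p))) = fact n * K"
  shows "class_expectation n mu X = K"
proof -
  let ?C = "conj_class n mu" and ?S = "{p. p permutes {1..n}}"
  have ne: "?C \<noteq> {}" using ex_cycle_type[OF mu] by (auto simp: conj_class_def)
  have "fact n * (\<Sum>w\<in>?C. real (X n w)) = (\<Sum>p\<in>?S. \<Sum>w\<in>?C. real (X n w))"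
    using card_permutations[of "{1..n}" n] by simp
  also have "\<dots> = (\<Sum>p\<in>?S. \<Sum>w\<in>?C. real (X n (p \<circ> w \<circ> inv p)))"
    by (intro sum.cong refl sum.reindex_bij_betw[symmetric] bij_betw_conj_class) simp
  also have "\<dots> = (\<Sum>w\<in>?C. \<Sum>p\<in>?S. real (X n (p \<circ> w \<circ> inv p)))"
    by (rule sum.swap)
  also have "\<dots> = fact n * (real (card ?C) * K)"
    using avg by simp
  finally have "(\<Sum>w\<in>?C. real (X n w)) = real (card ?C) * K" by simp
  then show ?thesis
    using ne finite_conj_class[of n mu]
    by (simp add: class_expectation_def integral_pmf_of_set)
qed

text \<open>Treats all four statistics at once: \<open>R\<close> compares preimage, point and image.
  Fixed points contribute nothing by \<open>R1\<close>, each of the 2 \<open>count mu 2\<close>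
  points on 2-cycles contributes \<open>\<beta>\<close>, and each point on a longer cycle
  contributes \<open>\<alpha>\<close>.\<close>

lemma class_expectation_pattern:
  fixes R :: "nat \<Rightarrow> nat \<Rightarrow> nat \<Rightarrow> bool"
  assumes mu: "mu \<turnstile>\<^sub>p n"
    and X: "\<And>w. X n w = card {i \<in> {1..n}. R (inv w i) i (w i)}"
    and R1: "\<And>x. \<not> R x x x"
    and R2: "\<And>a b. a \<in> {1..n} \<Longrightarrow> b \<in> {1..n} \<Longrightarrow> a \<noteq> b \<Longrightarrow>
      (\<Sum>p | p permutes {1..n}. of_bool (R (p a) (p b) (p a))) = fact n * \<beta>"
    and R3: "\<And>a b c. a \<in> {1..n} \<Longrightarrow> b \<in> {1..n} \<Longrightarrow> c \<in> {1..n} \<Longrightarrow> a \<noteq> b \<Longrightarrow> b \<noteq> c \<Longrightarrow> a \<noteq> c \<Longrightarrow>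
      (\<Sum>p | p permutes {1..n}. of_bool (R (p a) (p b) (p c))) = fact n * \<alpha>"
  shows "class_expectation n mu X =
    \<alpha> * (real n - real (count mu 1) - 2 * real (count mu 2)) + \<beta> * (2 * real (count mu 2))"
proof (rule class_expectation_eqI[OF mu])
  fix w assume "w \<in> conj_class n mu"
  then have w: "w permutes {1..n}" and type: "cycle_type n w = mu"
    by (auto simp: conj_class_def)
  let ?S = "{p. p permutes {1..n}}"
  let ?A = "{j \<in> {1..n}. w j = j}" and ?B = "{j \<in> {1..n}. w j \<noteq> j \<and> w (w j) = j}"
  have perm: "permutation w" using w permutation_permutes by blast
  have A: "card ?A = count mu 1" and B: "card ?B = 2 * count mu 2"
    using card_orbit_size[OF w, of 1] card_orbit_size[OF w, of 2]
      card_orbit_eq_1_iff[OF perm] card_orbit_eq_2_iff[OF perm] type by auto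
  have stat: "real (X n (p \<circ> w \<circ> inv p)) = (\<Sum>j\<in>{1..n}. of_bool (R (p (inv w j)) (p j) (p (w j))))"
    if p: "p permutes {1..n}" for p
  proof -
    have "inv (p \<circ> w \<circ> inv p) = p \<circ> inv w \<circ> inv p"
      using permutes_bij[OF p] permutes_bij[OF w] permutes_inv_inv[OF p]
      by (simp add: o_inv_distrib bij_comp bij_imp_bij_inv o_assoc)
    then have "real (X n (p \<circ> w \<circ> inv p)) =
        (\<Sum>i\<in>{1..n}. of_bool (R (p (inv w (inv p i))) i (p (w (inv p i)))))"
      by (simp add: X sum_of_bool_eq Int_def)
    \<comment> \<open>Substitute \<open>i = p j\<close>, so that the randomness sits only in the
      values of \<open>p\<close> at points determined by \<open>w\<close>.\<close>
    also have "\<dots> = (\<Sum>j\<in>{1..n}. of_bool (R (p (inv w j)) (p j) (p (w j))))"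
      using sum.reindex_bij_betw[OF permutes_imp_bij[OF p], symmetric,
          of "\<lambda>i. of_bool (R (p (inv w (inv p i))) i (p (w (inv p i)))) :: real"]
      by (simp add: permutes_inverses[OF p])
    finally show ?thesis .
  qed
  \<comment> \<open>The factor at \<open>\<alpha>\<close> is the indicator that \<open>j\<close>
    lies on a cycle of length at least 3, since \<open>?A\<close> and \<open>?B\<close> are
    disjoint.\<close>
  have avg: "(\<Sum>p\<in>?S. of_bool (R (p (inv w j)) (p j) (p (w j)))) =
      fact n * (\<alpha> * (1 - of_bool (j \<in> ?A) - of_bool (j \<in> ?B)) + \<beta> * of_bool (j \<in> ?B))"
    if j: "j \<in> {1..n}" for j
  proof -
    have mem: "w j \<in> {1..n}" "inv w j \<in> {1..n}"
      using permutes_in_image[OF w] permutes_in_image[OF permutes_inv[OF w]] j by auto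
    have inv: "inv w j = x \<longleftrightarrow> w x = j" for x
      using permutes_inv_eq[OF w] by simp
    consider "w j = j" | "w j \<noteq> j" "w (w j) = j" | "w j \<noteq> j" "w (w j) \<noteq> j" by blast
    then show ?thesis
    proof cases
      case 1
      then have "inv w j = j" by (simp add: inv)
      then show ?thesis using 1 j R1 by simp
    next
      case 2
      then have "inv w j = w j" by (simp add: inv)
      then show ?thesis using 2 j R2[OF mem(1) j] by simp
    next
      case 3
      then have "inv w j \<noteq> j" "inv w j \<noteq> w j" by (simp_all add: inv)
      then show ?thesis using 3 j R3[OF mem(2) j mem(1)] by simp
    qed
  qed
  have "(\<Sum>p\<in>?S. real (X n (p \<circ> w \<circ> inv p))) =
      (\<Sum>p\<in>?S. \<Sum>j\<in>{1..n}. of_bool (R (p (inv w j)) (p j) (p (w j))))"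
    using stat by simp
  also have "\<dots> = (\<Sum>j\<in>{1..n}. \<Sum>p\<in>?S. of_bool (R (p (inv w j)) (p j) (p (w j))))"
    by (rule sum.swap)
  also have "\<dots> = (\<Sum>j\<in>{1..n}.
      fact n * (\<alpha> * (1 - of_bool (j \<in> ?A) - of_bool (j \<in> ?B)) + \<beta> * of_bool (j \<in> ?B)))"
    using avg by (rule sum.cong[OF refl])
  also have "\<dots> = fact n * (\<alpha> * (real n - (\<Sum>j\<in>{1..n}. of_bool (j \<in> ?A)) -
      (\<Sum>j\<in>{1..n}. of_bool (j \<in> ?B))) + \<beta> * (\<Sum>j\<in>{1..n}. of_bool (j \<in> ?B)))"
    by (simp only: sum_distrib_left[symmetric] sum.distrib sum_subtractf) simp
  also have "(\<Sum>j\<in>{1..n}. of_bool (j \<in> ?A)) = real (card ?A)"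
    by (simp add: sum_of_bool_eq Int_def)
  also have "(\<Sum>j\<in>{1..n}. of_bool (j \<in> ?B)) = real (card ?B)"
    by (simp add: sum_of_bool_eq Int_def)
  finally show "(\<Sum>p\<in>?S. real (X n (p \<circ> w \<circ> inv p))) = fact n *
      (\<alpha> * (real n - real (count mu 1) - 2 * real (count mu 2)) + \<beta> * (2 * real (count mu 2)))"
    by (simp only: A B of_nat_mult of_nat_numeral)
qed

theorem theorem5p4:
  fixes n :: nat and mu :: "nat multiset"
  assumes "mu \<turnstile>\<^sub>p n"
  shows "class_expectation n mu cda = (real n - real (count mu 1) - 2 * real (count mu 2)) / 6
       \<and> class_expectation n mu cdd = (real n - real (count mu 1) - 2 * real (count mu 2)) / 6
       \<and> class_expectation n mu cv = (real n - real (count mu 1) + real (count mu 2)) / 3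
       \<and> class_expectation n mu cpk = (real n - real (count mu 1) + real (count mu 2)) / 3"
proof -
  \<comment> \<open>The interval is written with \<open>Suc 0\<close>, the form to which
    simplification brings \<open>{1..n}\<close>.\<close>
  note less = sum_of_bool_permutes_less[of "{Suc 0..n}"]
  note less_less = sum_of_bool_permutes_less_less[of "{Suc 0..n}"]
  note least = sum_of_bool_permutes_middle_least[of "{Suc 0..n}"]
  note greatest = sum_of_bool_permutes_middle_greatest[of "{Suc 0..n}"]
  \<comment> \<open>On a 2-cycle the outer values coincide, so no strict chain through the middle
    one exists; hence the coefficient 0, here and for \<open>cdd\<close>.\<close>
  have "class_expectation n mu cda =
      1/6 * (real n - real (count mu 1) - 2 * real (count mu 2)) + 0 * (2 * real (count mu 2))"
    by (rule class_expectation_pattern[where R = "\<lambda>x y z. x < y \<and> y < z", OF assms])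
      (auto simp: cda_def cyclic_double_ascent_def less_less intro!: sum.neutral)
  moreover have "class_expectation n mu cdd =
      1/6 * (real n - real (count mu 1) - 2 * real (count mu 2)) + 0 * (2 * real (count mu 2))"
    by (rule class_expectation_pattern[where R = "\<lambda>x y z. z < y \<and> y < x", OF assms])
      (auto simp: cdd_def cyclic_double_descent_def less_less intro!: sum.neutral arg_cong[where f = card])
  \<comment> \<open>On a 2-cycle both conditions become the same comparison of two values, which
    holds for half of the permutations; likewise for \<open>cpk\<close>.\<close>
  moreover have "class_expectation n mu cv =
      1/3 * (real n - real (count mu 1) - 2 * real (count mu 2)) + 1/2 * (2 * real (count mu 2))"
    by (rule class_expectation_pattern[where R = "\<lambda>x y z. y < x \<and> y < z", OF assms])
      (auto simp: cv_def cyclic_valley_def less least)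
  moreover have "class_expectation n mu cpk =
      1/3 * (real n - real (count mu 1) - 2 * real (count mu 2)) + 1/2 * (2 * real (count mu 2))"
    by (rule class_expectation_pattern[where R = "\<lambda>x y z. x < y \<and> z < y", OF assms])
      (auto simp: cpk_def cyclic_peak_def less greatest)
  ultimately show ?thesis by (simp add: field_simps)
qed

end
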